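(* Let $(\mathfrak{g},\alpha,\omega)$ be a cosymplectic Lie algebra and let $\varPhi:\mathfrak{g}\to\mathfrak{g}^*$ be the linear isomorphism $\varPhi(x)=\iota_x\omega+\alpha(x)\alpha$. Then the product $(x,y)\mapsto x.y$ on $\mathfrak{g}$ defined by $$\varPhi(x.y)(z)=-\varPhi(y)([x,z]),\qquad x,y,z\in\mathfrak{g},$$ is a left-symmetric product on $\mathfrak{g}$.
   Context: A cosymplectic Lie algebra $(\mathfrak{g},\alpha,\omega)$ is a real Lie algebra $\mathfrak{g}$ of dimension $2n+1$ with a 1-form $\alpha\in\mathfrak{g}^*$ and a 2-form $\omega\in\wedge^2\mathfrak{g}^*$ such that (1) $\alpha([x,y])=0$ for all $x,y\in\mathfrak{g}$; (2) $\omega([x,y],z)+\omega([y,z],x)+\omega([z,x],y)=0$ for all $x,y,z\in\mathfrak{g}$; (3) $\alpha\wedge\omega^n\neq 0$. Condition (3) is equivalent to $\varPhi$ being an isomorphism, where $\varPhi(x)(z)=\omega(x,z)+\alpha(x)\alpha(z)$. A bilinear product on $\mathfrak{g}$ is left-symmetric if $ass(x,y,z)=ass(y,x,z)$ for all $x,y,z$, where $ass(x,y,z)=(x.y).z-x.(y.z)$. *)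

theory Defs
  imports "HOL-Analysis.Analysis" "HOL-Combinatorics.Combinatorics"
begin

definition lie_bracket :: "('a::real_vector \<Rightarrow> 'a \<Rightarrow> 'a) \<Rightarrow> bool" where
  "lie_bracket br \<longleftrightarrow>
     bilinear br \<and> (\<forall>x. br x x = 0) \<and>
     (\<forall>x y z. br x (br y z) + br y (br z x) + br z (br x y) = 0)"

definition two_form :: "('a::real_vector \<Rightarrow> 'a \<Rightarrow> real) \<Rightarrow> bool" where
  "two_form \<omega> \<longleftrightarrow> bilinear \<omega> \<and> (\<forall>x. \<omega> x x = 0)"

(* In the wedge product, a k-form is a function of a sequence of vectors that depends only on
   the entries v 0, ..., v (k - 1).  The degree is not part of the type, so it is passed
   explicitly.  Normalisation: (dx1 \<and> ... \<and> dxm) (e1, ..., em) = 1. *)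

definition wedge ::
  "nat \<Rightarrow> nat \<Rightarrow> ((nat \<Rightarrow> 'a) \<Rightarrow> real) \<Rightarrow> ((nat \<Rightarrow> 'a) \<Rightarrow> real) \<Rightarrow> (nat \<Rightarrow> 'a) \<Rightarrow> real" where
  "wedge k l \<eta> \<theta> v =
     (\<Sum>\<sigma> | \<sigma> permutes {..<k + l}.
        of_int (sign \<sigma>) * \<eta> (\<lambda>i. v (\<sigma> i)) * \<theta> (\<lambda>i. v (\<sigma> (k + i)))) / (fact k * fact l)"

primrec wedge_power :: "nat \<Rightarrow> ((nat \<Rightarrow> 'a) \<Rightarrow> real) \<Rightarrow> nat \<Rightarrow> (nat \<Rightarrow> 'a) \<Rightarrow> real" where
  "wedge_power k \<eta> 0 = (\<lambda>v. 1)"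
| "wedge_power k \<eta> (Suc n) = wedge k (k * n) \<eta> (wedge_power k \<eta> n)"

definition alpha_wedge_omega_power ::
  "('a \<Rightarrow> real) \<Rightarrow> ('a \<Rightarrow> 'a \<Rightarrow> real) \<Rightarrow> nat \<Rightarrow> (nat \<Rightarrow> 'a) \<Rightarrow> real" where
  "alpha_wedge_omega_power \<alpha> \<omega> n =
     wedge 1 (2 * n) (\<lambda>v. \<alpha> (v 0)) (wedge_power 2 (\<lambda>v. \<omega> (v 0) (v 1)) n)"

(* The Lie algebra is the whole type 'a.  As dim is 0 for infinite-dimensional spaces, the
   dimension equation forces finite dimension. *)

definition cosymplectic_lie_algebra ::
  "('a::real_vector \<Rightarrow> 'a \<Rightarrow> 'a) \<Rightarrow> ('a \<Rightarrow> real) \<Rightarrow> ('a \<Rightarrow> 'a \<Rightarrow> real) \<Rightarrow> bool" where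
  "cosymplectic_lie_algebra br \<alpha> \<omega> \<longleftrightarrow>
     lie_bracket br \<and> linear \<alpha> \<and> two_form \<omega> \<and>
     (\<forall>x y. \<alpha> (br x y) = 0) \<and>
     (\<forall>x y z. \<omega> (br x y) z + \<omega> (br y z) x + \<omega> (br z x) y = 0) \<and>
     (\<exists>n. dim (UNIV :: 'a set) = 2 * n + 1 \<and> (\<exists>v. alpha_wedge_omega_power \<alpha> \<omega> n v \<noteq> 0))"

definition Phi :: "('a \<Rightarrow> real) \<Rightarrow> ('a \<Rightarrow> 'a \<Rightarrow> real) \<Rightarrow> 'a \<Rightarrow> 'a \<Rightarrow> real" where
  "Phi \<alpha> \<omega> x = (\<lambda>z. \<omega> x z + \<alpha> x * \<alpha> z)"

definition dual_space :: "('a::real_vector \<Rightarrow> real) set" where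
  "dual_space = {f. linear f}"

(* Linearity into the dual is stated pointwise because the function type carries no
   real_vector instance. *)

definition linear_iso_to_dual :: "('a::real_vector \<Rightarrow> 'a \<Rightarrow> real) \<Rightarrow> bool" where
  "linear_iso_to_dual F \<longleftrightarrow>
     (\<forall>z. linear (\<lambda>x. F x z)) \<and> bij_betw F UNIV dual_space"

definition cosymplectic_product ::
  "('a \<Rightarrow> 'a \<Rightarrow> 'a) \<Rightarrow> ('a \<Rightarrow> real) \<Rightarrow> ('a \<Rightarrow> 'a \<Rightarrow> real) \<Rightarrow> 'a \<Rightarrow> 'a \<Rightarrow> 'a" where
  "cosymplectic_product br \<alpha> \<omega> x y =
     (THE w. \<forall>z. Phi \<alpha> \<omega> w z = - Phi \<alpha> \<omega> y (br x z))"

definition associator :: "('a \<Rightarrow> 'a \<Rightarrow> 'a) \<Rightarrow> 'a \<Rightarrow> 'a \<Rightarrow> 'a \<Rightarrow> 'a::real_vector" where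
  "associator p x y z = p (p x y) z - p x (p y z)"

definition left_symmetric_product :: "('a::real_vector \<Rightarrow> 'a \<Rightarrow> 'a) \<Rightarrow> bool" where
  "left_symmetric_product p \<longleftrightarrow>
     bilinear p \<and> (\<forall>x y z. associator p x y z = associator p y x z)"

end

theory Submission
  imports Defs
begin

text \<open>A vector \<open>x \<noteq> 0\<close> with \<open>\<Phi>(x) = 0\<close> satisfies \<open>\<alpha>(x)\<^sup>2 = \<Phi>(x)(x) = 0\<close>, so it lies in the
  radical of both \<open>\<alpha>\<close> and \<open>\<omega>\<close>, and \<open>\<alpha> \<and> \<omega>\<^sup>n\<close> factors through a projection along \<open>x\<close>. The image
  of that projection has dimension \<open>2n\<close>, so the alternating \<open>(2n+1)\<close>-form \<open>\<alpha> \<and> \<omega>\<^sup>n\<close> vanishes. Hence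
  \<open>\<Phi>\<close> is injective, and by dimension an isomorphism. The product is the coadjoint
  representation transported by \<open>\<Phi>\<close>, so \<open>[x,y].z = x.(y.z) - y.(x.z)\<close>; closedness of \<open>\<omega>\<close> and
  \<open>\<alpha>([x,y]) = 0\<close> give \<open>x.y - y.x = [x,y]\<close>. Together these identities are left-symmetry.\<close>

section \<open>Alternating multilinear forms\<close>

text \<open>Arguments are infinite sequences, so the second clause bounds the entries that
  \<open>f\<close> can see. A wedge product relies on it when the varied entry belongs to the other
  factor.\<close>

definition multilinear_form :: "nat \<Rightarrow> ((nat \<Rightarrow> 'a::real_vector) \<Rightarrow> real) \<Rightarrow> bool" where
  "multilinear_form m f \<longleftrightarrow>
     (\<forall>v p. p < m \<longrightarrow> linear (\<lambda>x. f (v(p := x)))) \<and>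
     (\<forall>v w. (\<forall>i<m. v i = w i) \<longrightarrow> f v = f w)"

lemma multilinear_form_linear:
  "multilinear_form m f \<Longrightarrow> p < m \<Longrightarrow> linear (\<lambda>x. f (v(p := x)))"
  by (simp add: multilinear_form_def)

lemma multilinear_form_cong:
  assumes "multilinear_form m f" and "\<And>i. i < m \<Longrightarrow> v i = w i"
  shows "f v = f w"
  using assms unfolding multilinear_form_def by blast

text \<open>A permutation places the entry \<open>v p\<close> in exactly one slot of exactly one
  factor, so each summand is a linear function of it times a constant.\<close>

lemma multilinear_form_wedge:
  fixes \<eta> \<theta> :: "(nat \<Rightarrow> 'a::real_vector) \<Rightarrow> real"
  assumes \<eta>: "multilinear_form k \<eta>" and \<theta>: "multilinear_form l \<theta>"
  shows "multilinear_form (k + l) (wedge k l \<eta> \<theta>)"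
  unfolding multilinear_form_def
proof (intro conjI allI impI)
  fix v :: "nat \<Rightarrow> 'a" and p
  assume p: "p < k + l"
  have term_linear: "linear (\<lambda>x. of_int (sign \<sigma>) * \<eta> (\<lambda>i. (v(p := x)) (\<sigma> i))
      * \<theta> (\<lambda>i. (v(p := x)) (\<sigma> (k + i))))" if \<sigma>: "\<sigma> permutes {..<k + l}" for \<sigma>
  proof -
    \<comment> \<open>The slot that receives \<open>v p\<close> after permuting:
      \<open>q < k\<close> means it feeds \<open>\<eta>\<close>, otherwise it is argument
      \<open>q - k\<close> of \<open>\<theta>\<close>.\<close>
    define q where "q = inv \<sigma> p"
    have q: "\<sigma> i = p \<longleftrightarrow> i = q" for i
      using permutes_inv_eq[OF \<sigma>, of p i] q_def by auto
    have q_less: "q < k + l"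
      using permutes_in_image[OF \<sigma>, of q] q[of q] p by simp
    show ?thesis
    proof (cases "q < k")
      case True
      have 1: "(\<lambda>i. (v(p := x)) (\<sigma> i)) = (\<lambda>i. v (\<sigma> i))(q := x)" for x
        using q by auto
      have 2: "(\<lambda>i. (v(p := x)) (\<sigma> (k + i))) = (\<lambda>i. v (\<sigma> (k + i)))" for x
        using q True by auto
      show ?thesis
        unfolding 1 2 using multilinear_form_linear[OF \<eta> True, of "\<lambda>i. v (\<sigma> i)"]
        by (simp add: linear_iff algebra_simps)
    next
      case False
      then have ql: "q - k < l" using q_less by simp
      have 1: "\<eta> (\<lambda>i. (v(p := x)) (\<sigma> i)) = \<eta> (\<lambda>i. v (\<sigma> i))" for x
        using q False by (intro multilinear_form_cong[OF \<eta>]) auto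
      have 2: "(\<lambda>i. (v(p := x)) (\<sigma> (k + i))) = (\<lambda>i. v (\<sigma> (k + i)))(q - k := x)" for x
        using q False by (intro ext) auto
      show ?thesis
        unfolding 1 2 using multilinear_form_linear[OF \<theta> ql, of "\<lambda>i. v (\<sigma> (k + i))"]
        by (simp add: linear_iff algebra_simps)
    qed
  qed
  have "linear (\<lambda>x. \<Sum>\<sigma> | \<sigma> permutes {..<k + l}. of_int (sign \<sigma>) * \<eta> (\<lambda>i. (v(p := x)) (\<sigma> i))
      * \<theta> (\<lambda>i. (v(p := x)) (\<sigma> (k + i))))"
    using term_linear by (intro linear_compose_sum) blast
  then show "linear (\<lambda>x. wedge k l \<eta> \<theta> (v(p := x)))"
    unfolding wedge_def by (simp only: linear_iff add_divide_distrib real_scaleR_def times_divide_eq_right) simp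
next
  fix v w :: "nat \<Rightarrow> 'a"
  assume vw: "\<forall>i<k + l. v i = w i"
  show "wedge k l \<eta> \<theta> v = wedge k l \<eta> \<theta> w"
    unfolding wedge_def
  proof (intro arg_cong2[where f = "(/)"] sum.cong refl)
    fix \<sigma> assume "\<sigma> \<in> {\<sigma>. \<sigma> permutes {..<k + l}}"
    then have "\<sigma> i < k + l" if "i < k + l" for i
      using permutes_in_image[of \<sigma> "{..<k + l}" i] that by simp
    then have "\<eta> (\<lambda>i. v (\<sigma> i)) = \<eta> (\<lambda>i. w (\<sigma> i))"
      and "\<theta> (\<lambda>i. v (\<sigma> (k + i))) = \<theta> (\<lambda>i. w (\<sigma> (k + i)))"
      using vw by (auto intro!: multilinear_form_cong[OF \<eta>] multilinear_form_cong[OF \<theta>])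
    then show "of_int (sign \<sigma>) * \<eta> (\<lambda>i. v (\<sigma> i)) * \<theta> (\<lambda>i. v (\<sigma> (k + i)))
        = of_int (sign \<sigma>) * \<eta> (\<lambda>i. w (\<sigma> i)) * \<theta> (\<lambda>i. w (\<sigma> (k + i)))"
      by simp
  qed
qed

lemma multilinear_form_wedge_power:
  "multilinear_form k \<eta> \<Longrightarrow> multilinear_form (k * n) (wedge_power k \<eta> n)"
proof (induction n)
  case 0
  then show ?case by (simp add: multilinear_form_def)
next
  case (Suc n)
  then show ?case using multilinear_form_wedge[of k \<eta> "k * n"] by simp
qed

text \<open>Left composition with \<open>\<tau>\<close> only reorders the summation over
  permutations; the factor \<open>sign \<tau>\<close> comes out because sign is multiplicative and
  \<open>sign \<tau>\<close> squares to 1.\<close>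

lemma wedge_permute:
  assumes \<tau>: "\<tau> permutes {..<k + l}"
  shows "wedge k l \<eta> \<theta> (\<lambda>i. v (\<tau> i)) = of_int (sign \<tau>) * wedge k l \<eta> \<theta> v"
proof -
  let ?g = "\<lambda>\<sigma>. of_int (sign \<sigma>) * \<eta> (\<lambda>i. v (\<sigma> i)) * \<theta> (\<lambda>i. v (\<sigma> (k + i)))"
  have "(\<Sum>\<sigma> | \<sigma> permutes {..<k + l}. of_int (sign \<sigma>) * \<eta> (\<lambda>i. v (\<tau> (\<sigma> i)))
          * \<theta> (\<lambda>i. v (\<tau> (\<sigma> (k + i)))))
      = (\<Sum>\<sigma> | \<sigma> permutes {..<k + l}. of_int (sign \<tau>) * ?g (\<tau> \<circ> \<sigma>))"
  proof (intro sum.cong refl)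
    fix \<sigma> assume "\<sigma> \<in> {\<sigma>. \<sigma> permutes {..<k + l}}"
    then have "sign (\<tau> \<circ> \<sigma>) = sign \<tau> * sign \<sigma>"
      using \<tau> by (intro sign_compose permutes_imp_permutation[of "{..<k + l}"]) auto
    then show "of_int (sign \<sigma>) * \<eta> (\<lambda>i. v (\<tau> (\<sigma> i))) * \<theta> (\<lambda>i. v (\<tau> (\<sigma> (k + i))))
        = of_int (sign \<tau>) * ?g (\<tau> \<circ> \<sigma>)"
      by (auto simp: sign_def)
  qed
  also have "\<dots> = of_int (sign \<tau>) * (\<Sum>\<sigma> | \<sigma> permutes {..<k + l}. ?g \<sigma>)"
    by (simp add: sum_distrib_left setum_permutations_compose_left[OF \<tau>, of ?g])
  finally show ?thesis by (simp add: wedge_def)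
qed

text \<open>Swapping two equal entries fixes \<open>v\<close> but flips the sign, so the value
  equals its own negative.\<close>

lemma wedge_eq_0_if_repeated:
  assumes "i < k + l" "j < k + l" "i \<noteq> j" "v i = v j"
  shows "wedge k l \<eta> \<theta> v = 0"
proof -
  let ?t = "Transposition.transpose i j"
  have "?t permutes {..<k + l}"
    using assms by (intro permutes_swap_id) auto
  moreover have "(\<lambda>r. v (?t r)) = v"
    using assms by (auto simp: Transposition.transpose_def)
  ultimately show ?thesis
    using wedge_permute[of ?t k l \<eta> \<theta> v] assms by (simp add: sign_swap_id)
qed

text \<open>Some \<open>v p\<close> lies in the span of the other values. As a function of slot
  \<open>p\<close>, the form is linear and kills each of those values by alternation, hence their
  whole span.\<close>

lemma alternating_eq_0_if_dependent:
  assumes ml: "multilinear_form m f"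
    and alt: "\<And>v i j. i < m \<Longrightarrow> j < m \<Longrightarrow> i \<noteq> j \<Longrightarrow> v i = v j \<Longrightarrow> f v = 0"
    and dep: "dependent (v ` {..<m})"
  shows "f v = 0"
proof -
  obtain p where p: "p < m" and span: "v p \<in> span (v ` {..<m} - {v p})"
    using dep unfolding dependent_def by auto
  have "f (v(p := v p)) = 0"
  proof (rule linear_eq_0_on_span[OF multilinear_form_linear[OF ml p] _ span])
    fix x assume "x \<in> v ` {..<m} - {v p}"
    then obtain j where "j < m" "x = v j" "j \<noteq> p" by auto
    then show "f (v(p := x)) = 0" using p by (intro alt[of p j]) auto
  qed
  then show ?thesis by simp
qed

lemma wedge_comp_invariant:
  assumes "\<And>v. \<eta> (\<lambda>i. P (v i)) = \<eta> v" "\<And>v. \<theta> (\<lambda>i. P (v i)) = \<theta> v"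
  shows "wedge k l \<eta> \<theta> (\<lambda>i. P (v i)) = wedge k l \<eta> \<theta> v"
  by (simp add: wedge_def assms)

lemma wedge_power_comp_invariant:
  assumes "\<And>v. \<eta> (\<lambda>i. P (v i)) = \<eta> v"
  shows "wedge_power k \<eta> n (\<lambda>i. P (v i)) = wedge_power k \<eta> n v"
  by (induction n arbitrary: v) (simp_all add: wedge_comp_invariant assms)

section \<open>Finite-dimensional duality\<close>

lemma finite_basis_of_dim_pos:
  assumes "dim (UNIV :: 'a::real_vector set) > 0"
  obtains B :: "'a::real_vector set" where "finite B" "independent B" "span B = UNIV"
    "card B = dim (UNIV :: 'a set)"
proof -
  obtain B :: "'a set" where B: "independent B" "UNIV \<subseteq> span B" "card B = dim (UNIV :: 'a set)"
    by (metis basis_exists)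
  \<comment> \<open>An infinite set has \<open>card\<close> 0, so positive dimension forces a finite
    basis.\<close>
  moreover have "finite B" using assms B(3) by (intro card_ge_0_finite) simp
  ultimately show ?thesis by (intro that[of B]) auto
qed

lemma independent_card_le_dim_UNIV:
  fixes S :: "'a::real_vector set"
  assumes "dim (UNIV :: 'a set) > 0" "independent S"
  shows "card S \<le> dim (UNIV :: 'a set)"
proof -
  obtain B :: "'a set" where "finite B" "span B = UNIV" "card B = dim (UNIV :: 'a set)"
    using finite_basis_of_dim_pos[OF assms(1)] by metis
  then show ?thesis using independent_span_bound[of B S] assms(2) by simp
qed

lemma nondegenerate_imp_linear_iso_to_dual:
  fixes F :: "'a::real_vector \<Rightarrow> 'a \<Rightarrow> real"
  assumes dim: "dim (UNIV :: 'a set) > 0" and bil: "bilinear F"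
    and nondeg: "\<And>x. (\<And>z. F x z = 0) \<Longrightarrow> x = 0"
  shows "linear_iso_to_dual F"
proof -
  obtain B :: "'a set" where B: "finite B" "independent B" "span B = UNIV"
      "card B = dim (UNIV :: 'a set)"
    using finite_basis_of_dim_pos[OF dim] .
  have lin1: "linear (\<lambda>x. F x z)" and lin2: "linear (F x)" for x z
    using bil by (simp_all add: bilinear_def)
  have eqI: "f = g" if "linear f" "linear g" "\<And>b. b \<in> B \<Longrightarrow> f b = g b" for f g :: "'a \<Rightarrow> real"
    using linear_eq_on_span[OF that] B(3) by auto
  have coord: "c b = d b" if "b \<in> B" "(\<Sum>b\<in>B. c b *\<^sub>R b) = (\<Sum>b\<in>B. d b *\<^sub>R b)" for b c d
  proof -
    have "(\<Sum>b\<in>B. (c b - d b) *\<^sub>R b) = 0"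
      using that(2) by (simp add: scaleR_left_diff_distrib sum_subtractf)
    then show ?thesis using independentD[OF B(2) B(1) order_refl, of "\<lambda>b. c b - d b"] that(1) by auto
  qed
  \<comment> \<open>The values of \<open>F x\<close> on the basis become coordinates of a vector.
    This turns \<open>F\<close> into an endomorphism of \<open>'a\<close>, where dimensions can be
    counted.\<close>
  define T where "T x = (\<Sum>b\<in>B. F x b *\<^sub>R b)" for x
  have linT: "linear T"
    unfolding T_def using lin1
    by (intro linear_compose_sum) (auto simp: linear_iff scaleR_left_distrib)
  have injF: "inj F"
  proof (rule injI)
    fix x y assume "F x = F y"
    then have "F (x - y) z = 0" for z
      using linear_diff[OF lin1, of x y z] by simp
    then show "x = y" using nondeg[of "x - y"] by simp
  qed
  have injT: "inj T"
  proof (rule injI)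
    fix x y assume "T x = T y"
    then have "F x b = F y b" if "b \<in> B" for b
      using coord[OF that] unfolding T_def by blast
    then show "x = y" using eqI[OF lin2 lin2] injF by (auto dest: injD)
  qed
  \<comment> \<open>\<open>T\<close> carries \<open>B\<close> to an independent set of the same
    size; a vector outside its span would give an independent set larger than the dimension.\<close>
  have surjT: "y \<in> span (T ` B)" for y
  proof (rule ccontr)
    assume y: "y \<notin> span (T ` B)"
    have "independent (T ` B)"
      using linear_independent_injective_image[OF linT B(2)] injT by (auto intro: inj_on_subset)
    then have "independent (insert y (T ` B))"
      using y by (simp add: independent_insert)
    then have "card (insert y (T ` B)) \<le> card B"
      using independent_card_le_dim_UNIV[OF dim] B(4) by metis
    moreover have "y \<notin> T ` B" using y by (metis span_base)
    moreover have "card (T ` B) = card B" using injT by (intro card_image) (auto intro: inj_on_subset)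
    ultimately show False using B(1) by simp
  qed
  \<comment> \<open>Pull back under \<open>T\<close> the vector whose coordinates are the values
    \<open>f b\<close>; the functional of the preimage agrees with \<open>f\<close> on a
    basis.\<close>
  have "f \<in> range F" if f: "linear f" for f
  proof -
    have "(\<Sum>b\<in>B. f b *\<^sub>R b) \<in> range T"
      using surjT linear_span_image[OF linT, of B] B(3) by auto
    then obtain x where "(\<Sum>b\<in>B. f b *\<^sub>R b) = T x" by auto
    then have "f b = F x b" if "b \<in> B" for b
      using coord[OF that] unfolding T_def by blast
    then show ?thesis using eqI[OF f lin2] by auto
  qed
  then have "range F = dual_space"
    using lin2 by (auto simp: dual_space_def)
  then show ?thesis
    using injF lin1 by (simp add: linear_iso_to_dual_def bij_betw_def)
qed

section \<open>Cosymplectic Lie algebras\<close>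

lemma alpha_wedge_omega_power_eq_0:
  fixes \<alpha> :: "'a::real_vector \<Rightarrow> real"
  assumes \<alpha>: "linear \<alpha>" and \<omega>: "two_form \<omega>" and dim: "dim (UNIV :: 'a set) = 2 * n + 1"
    and x: "x \<noteq> 0" "\<alpha> x = 0" "\<And>z. \<omega> x z = 0"
  shows "alpha_wedge_omega_power \<alpha> \<omega> n v = 0"
proof -
  let ?f = "alpha_wedge_omega_power \<alpha> \<omega> n"
  have bil: "bilinear \<omega>" using \<omega> by (simp add: two_form_def)
  have xr: "\<omega> z x = 0" for z
  proof -
    have "\<omega> (x + z) (x + z) = 0" "\<omega> x x = 0" "\<omega> z z = 0"
      using \<omega> by (simp_all add: two_form_def)
    then show ?thesis using x(3) by (simp add: bilinear_ladd[OF bil] bilinear_radd[OF bil])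
  qed
  have "independent {x}" using x(1) by simp
  then obtain \<phi> :: "'a \<Rightarrow> real" where \<phi>: "linear \<phi>" "\<phi> x = 1"
    using linear_independent_extend[of "{x}" "\<lambda>_. 1::real"] by auto
  \<comment> \<open>The projection onto the kernel of \<open>\<phi>\<close> along \<open>x\<close>.
    It changes its argument only by multiples of \<open>x\<close>, to which \<open>\<alpha>\<close>
    and \<open>\<omega>\<close> are blind.\<close>
  define P where "P y = y - \<phi> y *\<^sub>R x" for y
  have \<phi>P: "\<phi> (P y) = 0" for y
    using \<phi> by (simp add: P_def linear_diff linear_scale)
  have \<alpha>P: "\<alpha> (P y) = \<alpha> y" for y
    using \<alpha> x(2) by (simp add: P_def linear_diff linear_scale)
  have \<omega>P: "\<omega> (P y) (P z) = \<omega> y z" for y z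
    by (simp add: P_def bilinear_lsub[OF bil] bilinear_rsub[OF bil] bilinear_lmul[OF bil]
        bilinear_rmul[OF bil] x(3) xr)
  have f_eq: "?f (\<lambda>i. P (v i)) = ?f v"
    unfolding alpha_wedge_omega_power_def
    by (intro wedge_comp_invariant wedge_power_comp_invariant) (simp_all add: \<alpha>P \<omega>P)
  have ml\<omega>: "multilinear_form 2 (\<lambda>v. \<omega> (v 0) (v 1))"
    unfolding multilinear_form_def
  proof (intro conjI allI impI)
    fix v :: "nat \<Rightarrow> 'a" and p :: nat
    assume "p < 2"
    then have "p = 0 \<or> p = 1" by auto
    then show "linear (\<lambda>x. \<omega> ((v(p := x)) 0) ((v(p := x)) 1))"
      using bil by (auto simp: bilinear_def)
  qed auto
  have ml\<alpha>: "multilinear_form 1 (\<lambda>v. \<alpha> (v 0))"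
    using \<alpha> by (auto simp: multilinear_form_def)
  have ml: "multilinear_form (1 + 2 * n) ?f"
    unfolding alpha_wedge_omega_power_def
    by (intro multilinear_form_wedge multilinear_form_wedge_power ml\<alpha> ml\<omega>)
  have alt: "?f w = 0" if "i < 1 + 2 * n" "j < 1 + 2 * n" "i \<noteq> j" "w i = w j" for w i j
    using that unfolding alpha_wedge_omega_power_def by (rule wedge_eq_0_if_repeated)
  let ?u = "\<lambda>i. P (v i)"
  let ?S = "?u ` {..<1 + 2 * n}"
  have "?f ?u = 0"
  \<comment> \<open>Dependence is a property of the set \<open>?S\<close>, which forgets
    repetitions; a repeated entry is therefore settled by alternation alone.\<close>
  proof (cases "inj_on ?u {..<1 + 2 * n}")
    case False
    then show ?thesis using alt by (auto simp: inj_on_def)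
  next
    case inj: True
    \<comment> \<open>\<open>\<phi>\<close> separates \<open>x\<close> from \<open>span ?S\<close>.
      Were \<open>?S\<close> independent, adjoining \<open>x\<close> would give
      \<open>2 * n + 2\<close> independent vectors.\<close>
    have "\<phi> y = 0" if "y \<in> span ?S" for y
      using that by (rule linear_eq_0_on_span[OF \<phi>(1), rotated]) (auto simp: \<phi>P)
    then have notin: "x \<notin> span ?S" using \<phi>(2) by force
    have "dependent ?S"
    proof (rule ccontr)
      assume "independent ?S"
      then have "independent (insert x ?S)"
        using notin by (simp add: independent_insert)
      then have "card (insert x ?S) \<le> 2 * n + 1"
        using independent_card_le_dim_UNIV[of "insert x ?S"] dim by simp
      moreover have "x \<notin> ?S" using notin by (metis span_base)
      ultimately show False using card_image[OF inj] by simp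
    qed
    then show ?thesis using alternating_eq_0_if_dependent[OF ml, of ?u] alt by blast
  qed
  then show ?thesis using f_eq by simp
qed

lemma cosymplectic_Phi_iso:
  fixes br :: "'a::real_vector \<Rightarrow> 'a \<Rightarrow> 'a"
  assumes "cosymplectic_lie_algebra br \<alpha> \<omega>"
  shows "linear_iso_to_dual (Phi \<alpha> \<omega>)"
proof -
  from assms obtain n v where \<alpha>: "linear \<alpha>" and \<omega>: "two_form \<omega>"
    and dim: "dim (UNIV :: 'a set) = 2 * n + 1" and v: "alpha_wedge_omega_power \<alpha> \<omega> n v \<noteq> 0"
    unfolding cosymplectic_lie_algebra_def by blast
  have bil: "bilinear \<omega>" using \<omega> by (simp add: two_form_def)
  show ?thesis
  proof (rule nondegenerate_imp_linear_iso_to_dual)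
    show "bilinear (Phi \<alpha> \<omega>)"
      using bil \<alpha> by (simp add: bilinear_def linear_iff Phi_def algebra_simps)
    fix x assume x: "\<And>z. Phi \<alpha> \<omega> x z = 0"
    have "\<alpha> x = 0" using x[of x] \<omega> by (simp add: Phi_def two_form_def)
    moreover from this have "\<omega> x z = 0" for z using x[of z] by (simp add: Phi_def)
    ultimately show "x = 0" using alpha_wedge_omega_power_eq_0[OF \<alpha> \<omega> dim] v by blast
  qed (use dim in simp)
qed

theorem theorem2p1:
  fixes br :: "'a::real_vector \<Rightarrow> 'a \<Rightarrow> 'a"
    and \<alpha> :: "'a \<Rightarrow> real"
    and \<omega> :: "'a \<Rightarrow> 'a \<Rightarrow> real"
  assumes "cosymplectic_lie_algebra br \<alpha> \<omega>"
  shows "linear_iso_to_dual (Phi \<alpha> \<omega>) \<and>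
    (\<forall>x y z. Phi \<alpha> \<omega> (cosymplectic_product br \<alpha> \<omega> x y) z = - Phi \<alpha> \<omega> y (br x z)) \<and>
    left_symmetric_product (cosymplectic_product br \<alpha> \<omega>)"
proof -
  let ?F = "Phi \<alpha> \<omega>" and ?p = "cosymplectic_product br \<alpha> \<omega>"
  have br: "bilinear br" and br0: "br x x = 0"
    and jac: "br x (br y z) + br y (br z x) + br z (br x y) = 0"
    and \<alpha>: "linear \<alpha>" and \<omega>: "bilinear \<omega>" and \<omega>0: "\<omega> x x = 0" and \<alpha>br: "\<alpha> (br x y) = 0"
    and closed: "\<omega> (br x y) z + \<omega> (br y z) x + \<omega> (br z x) y = 0" for x y z
    using assms
    unfolding cosymplectic_lie_algebra_def lie_bracket_def two_form_def by blast+
  have br_anti: "br y x = - br x y" for x y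
    using br0[of "x + y"] br0[of x] br0[of y]
    by (simp add: bilinear_ladd[OF br] bilinear_radd[OF br] eq_neg_iff_add_eq_0 add.commute)
  have \<omega>_anti: "\<omega> y x = - \<omega> x y" for x y
    using \<omega>0[of "x + y"] \<omega>0[of x] \<omega>0[of y]
    by (simp add: bilinear_ladd[OF \<omega>] bilinear_radd[OF \<omega>])
  have iso: "linear_iso_to_dual ?F" using cosymplectic_Phi_iso[OF assms] .
  have lin1: "linear (\<lambda>x. ?F x z)" for z
    using iso by (simp add: linear_iso_to_dual_def)
  have lin2: "linear (?F x)" for x
    using \<omega> \<alpha> by (simp add: bilinear_def linear_iff Phi_def algebra_simps)
  note F_simps = linear_add[OF lin1] linear_diff[OF lin1] linear_scale[OF lin1]
    linear_add[OF lin2] linear_diff[OF lin2] linear_scale[OF lin2] linear_neg[OF lin2]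
  have eqI: "x = y" if "\<And>z. ?F x z = ?F y z" for x y
    using iso that unfolding linear_iso_to_dual_def bij_betw_def by (metis ext injD)
  have p: "?F (?p x y) z = - ?F y (br x z)" for x y z
  proof -
    have "linear (\<lambda>z. - ?F y (br x z))"
      using br by (simp add: linear_iff F_simps bilinear_radd bilinear_rmul)
    then have "(\<lambda>z. - ?F y (br x z)) \<in> range ?F"
      using iso unfolding linear_iso_to_dual_def bij_betw_def dual_space_def by simp
    then obtain w where w: "?F w = (\<lambda>z. - ?F y (br x z))" by auto
    \<comment> \<open>Existence is surjectivity of \<open>?F\<close> onto the dual and uniqueness is
      its injectivity; together they justify the definite description behind
      \<open>?p\<close>.\<close>
    have "\<exists>!w. \<forall>z. ?F w z = - ?F y (br x z)"
    proof (rule ex1I)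
      show "\<forall>z. ?F w z = - ?F y (br x z)" using w by metis
      show "w' = w" if "\<forall>z. ?F w' z = - ?F y (br x z)" for w'
        using that w by (intro eqI) metis
    qed
    then have "\<forall>z. ?F (?p x y) z = - ?F y (br x z)"
      unfolding cosymplectic_product_def by (rule theI')
    then show ?thesis by blast
  qed
  have p_bil: "bilinear ?p"
    unfolding bilinear_def linear_iff
    by (intro conjI allI; rule eqI)
      (simp_all add: p F_simps bilinear_ladd[OF br] bilinear_lmul[OF br])
  \<comment> \<open>The \<open>\<alpha>\<close> terms vanish on brackets. What remains is
    \<open>\<omega> x (br y z) - \<omega> y (br x z)\<close>, which closedness and antisymmetry turn
    into \<open>\<omega> (br x y) z\<close>.\<close>
  have comm: "?p x y - ?p y x = br x y" for x y
  proof (rule eqI)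
    fix z
    show "?F (?p x y - ?p y x) z = ?F (br x y) z"
      using closed[of x y z] \<omega>_anti[of "br x z" y] \<omega>_anti[of "br y z" x] br_anti[of z x]
      by (simp add: F_simps p) (simp add: Phi_def \<alpha>br bilinear_lneg[OF \<omega>])
  qed
  have rep: "?p (br x y) z = ?p x (?p y z) - ?p y (?p x z)" for x y z
  proof (rule eqI)
    fix t
    \<comment> \<open>Jacobi in the form that the adjoint map of a bracket is the commutator of
      adjoint maps. Applying \<open>p\<close> twice reverses the order of the brackets and cancels
      the two signs, leaving the minus sign that the left side needs.\<close>
    have "br (br x y) t = br x (br y t) - br y (br x t)"
      using jac[of x y t] br_anti[of t "br x y"] br_anti[of t x]
      by (simp add: bilinear_rneg[OF br] algebra_simps)
    then show "?F (?p (br x y) z) t = ?F (?p x (?p y z) - ?p y (?p x z)) t"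
      by (simp add: F_simps p)
  qed
  \<comment> \<open>The two associators differ by
    \<open>(x.y - y.x).z - (x.(y.z) - y.(x.z))\<close>; \<open>comm\<close> and \<open>rep\<close>
    identify both parts with \<open>[x,y].z\<close>.\<close>
  have "associator ?p x y z = associator ?p y x z" for x y z
  proof -
    have "?p (?p x y) z - ?p (?p y x) z = ?p (br x y) z"
      by (metis comm bilinear_lsub[OF p_bil])
    then show ?thesis
      unfolding rep associator_def by (simp add: algebra_simps)
  qed
  then show ?thesis
    using iso p p_bil by (simp add: left_symmetric_product_def)
qed

end
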